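(* Let $I \subseteq \mathbf{R}$ be a non-empty interval, let $(S, \mathscr{C}, \gamma)$ be a probability space, and assume $w: I \to \mathbf{R}$ and $h: S \to I$ are functions such that $w[I]$ is an interval and $w \circ h$ is $\gamma$-integrable. Then $\int_S w \circ h \, d\gamma \in w[I]$.
   Context: The interval $I$ may be bounded or unbounded, and need not be open or closed. $w[I] = \{w(x): x \in I\}$ denotes the image of $I$ under $w$. Integration is in the sense of Lebesgue (a $\gamma$-integrable function has a finite integral). *)

theory Defs
  imports "HOL-Probability.Probability"
begin

end

theory Submission
  imports Defs
begin

text \<open>
  The mean of a random variable with values in an interval \<open>J\<close> lies in \<open>J\<close>, whichever
  end points \<open>J\<close> contains; the theorem is this fact for \<open>w \<circ> h\<close> and \<open>J = w ` I\<close>.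
  A point outside \<open>J\<close> has all of \<open>J\<close> strictly on one side. If the mean were such a point,
  the variable would be strictly below (or strictly above) its own mean everywhere, although on
  a probability space strict bounds pass to the mean.
\<close>

lemma (in prob_space) expectation_mem_interval:
  fixes X :: "'a \<Rightarrow> real"
  assumes X: "integrable M X" and J: "is_interval J"
    and mem: "\<And>s. s \<in> space M \<Longrightarrow> X s \<in> J"
  shows "expectation X \<in> J"
proof (rule ccontr)
  assume out: "expectation X \<notin> J"
  have "(\<forall>y\<in>J. y < expectation X) \<or> (\<forall>y\<in>J. expectation X < y)"
    using J out unfolding is_interval_1 by (meson not_le_imp_less)
  then show False
  proof
    assume "\<forall>y\<in>J. y < expectation X"
    then have "AE s in M. X s < expectation X"
      using mem by (intro AE_I2) blast
    then show False
      using expectation_less[OF X] by blast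
  next
    assume "\<forall>y\<in>J. expectation X < y"
    then have "AE s in M. expectation X < X s"
      using mem by (intro AE_I2) blast
    then show False
      using expectation_greater[OF X] by blast
  qed
qed

theorem proposition1:
  fixes I :: "real set" and \<gamma> :: "'s measure" and w :: "real \<Rightarrow> real" and h :: "'s \<Rightarrow> real"
  assumes "is_interval I" and "I \<noteq> {}"
    and "prob_space \<gamma>"
    and "h \<in> space \<gamma> \<rightarrow> I"
    and "is_interval (w ` I)"
    and "integrable \<gamma> (w \<circ> h)"
  shows "(\<integral>s. (w \<circ> h) s \<partial>\<gamma>) \<in> w ` I"
proof -
  have "(w \<circ> h) s \<in> w ` I" if "s \<in> space \<gamma>" for s
    using assms(4) that by auto
  then show ?thesis
    using prob_space.expectation_mem_interval[OF assms(3,6,5)] by blast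
qed

end
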